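(* Let $f\in\mathcal{BT}_{\mathfrak{B}}$ with $f(z)=z+\sum_{n=2}^{\infty}a_nz^n$. Then $$|\sigma_3(f)(0)|\le 1,\qquad |\sigma_4(f)(0)|\le 3,$$ and both bounds are sharp. The bound $|\sigma_3(f)(0)|=1$ is attained by the function $f_5\in\mathcal{BT}_{\mathfrak{B}}$, $$f_5(z)=\int_0^z\sqrt{1+\tanh(\zeta^2)}\,d\zeta,$$ and the bound $|\sigma_4(f)(0)|=3$ is attained by the function $f_6\in\mathcal{BT}_{\mathfrak{B}}$, $$f_6(z)=\int_0^z\sqrt{1+\tanh(\zeta^3)}\,d\zeta.$$
   Context: Let $\mathbb{D}=\{z\in\mathbb{C}:|z|<1\}$. Let $\mathcal{A}$ be the class of analytic functions $f$ on $\mathbb{D}$ with $f(0)=0$, $f'(0)=1$. A Schwarz function is an analytic function $\omega$ on $\mathbb{D}$ with $\omega(0)=0$ and $|\omega(z)|<1$ for all $z\in\mathbb{D}$. For analytic functions $g,h$ on $\mathbb{D}$, $g\prec h$ ($g$ is subordinate to $h$) means $g(z)=h(\omega(z))$ on $\mathbb{D}$ for some Schwarz function $\omega$. Let $\mathfrak{B}(z)=\sqrt{1+\tanh z}$ for $z\in\mathbb{D}$ (principal branch, so $\mathfrak{B}(0)=1$). The bean-domain class is $$\mathcal{BT}_{\mathfrak{B}}=\{f\in\mathcal{A}: f'(z)\prec\mathfrak{B}(z)\}.$$ For locally univalent $f$, the higher-order Schwarzian derivatives (Schippers functionals) are defined by $$\sigma_3(f)=\left(\frac{f''}{f'}\right)'-\frac12\left(\frac{f''}{f'}\right)^2,\qquad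 \sigma_{n+1}(f)=\sigma_n'(f)-(n-1)\,\sigma_n(f)\,\frac{f''}{f'}\quad(n\ge 3),$$ where $\sigma_n'(f)$ is the derivative in $z$ of $\sigma_n(f)$. For $f(z)=z+\sum_{n\ge2}a_nz^n$ one has $\sigma_3(f)(0)=6(a_3-a_2^2)$ and $\sigma_4(f)(0)=24(a_4-3a_2a_3+2a_2^3)$. *)

theory Defs
  imports "HOL-Complex_Analysis.Complex_Analysis"
begin

abbreviation unit_disc :: "complex set" where
  "unit_disc \<equiv> ball 0 1"

definition class_A :: "(complex \<Rightarrow> complex) set" where
  "class_A = {f. f holomorphic_on unit_disc \<and> f 0 = 0 \<and> deriv f 0 = 1}"

definition schwarz_function :: "(complex \<Rightarrow> complex) \<Rightarrow> bool" where
  "schwarz_function \<omega> \<longleftrightarrow>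
     \<omega> holomorphic_on unit_disc \<and> \<omega> 0 = 0 \<and> (\<forall>z\<in>unit_disc. cmod (\<omega> z) < 1)"

definition subordinate :: "(complex \<Rightarrow> complex) \<Rightarrow> (complex \<Rightarrow> complex) \<Rightarrow> bool"
    (infix "\<prec>\<^sub>s" 50) where
  "g \<prec>\<^sub>s h \<longleftrightarrow>
     g holomorphic_on unit_disc \<and> h holomorphic_on unit_disc \<and>
     (\<exists>\<omega>. schwarz_function \<omega> \<and> (\<forall>z\<in>unit_disc. g z = h (\<omega> z)))"

(* On the unit disc 1 + tanh z avoids the closed negative real axis, so the
   principal square root csqrt is holomorphic there. *)
definition bean :: "complex \<Rightarrow> complex" where
  "bean z = csqrt (1 + tanh z)"

definition BT_bean :: "(complex \<Rightarrow> complex) set" where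
  "BT_bean = {f \<in> class_A. deriv f \<prec>\<^sub>s bean}"

(* schippers n f is the n-th order Schwarzian derivative of f, for n \<ge> 3.  The
   recursion is on Suc n: the branch n = 2 is the classical Schwarzian (order 3),
   and for n \<ge> 3 it gives order n + 1.  Orders below 3 have no meaning and are
   set to 0; they do not enter the recursion. *)
fun schippers :: "nat \<Rightarrow> (complex \<Rightarrow> complex) \<Rightarrow> complex \<Rightarrow> complex" where
  "schippers 0 f z = 0"
| "schippers (Suc n) f z =
    (if n < 2 then 0
     else if n = 2 then
       deriv (\<lambda>w. deriv (deriv f) w / deriv f w) z - 1/2 * (deriv (deriv f) z / deriv f z)\<^sup>2
     else
       deriv (schippers n f) z
         - of_nat (n - 1) * schippers n f z * (deriv (deriv f) z / deriv f z))"

definition f5 :: "complex \<Rightarrow> complex" where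
  "f5 z = contour_integral (linepath 0 z) (\<lambda>\<zeta>. csqrt (1 + tanh (\<zeta> ^ 2)))"

definition f6 :: "complex \<Rightarrow> complex" where
  "f6 z = contour_integral (linepath 0 z) (\<lambda>\<zeta>. csqrt (1 + tanh (\<zeta> ^ 3)))"

end

theory Submission
  imports Defs
begin

text \<open>
  Let \<open>f' = bean \<circ> \<omega>\<close> with a Schwarz function \<open>\<omega> z = c1 * z + c2 * z\<^sup>2 + c3 * z^3 + \<dots>\<close>.  Since
  \<open>bean\<^sup>2 = 1 + tanh\<close>, the logarithmic derivative \<open>f''/f'\<close> equals \<open>(1 - tanh \<omega>) * \<omega>' / 2\<close>, and its
  first three Taylor coefficients give
  \<open>\<sigma>3 = c2 - 5/8 * c1\<^sup>2\<close> and \<open>\<sigma>4 = 3 * (c3 - 3/2 * c1 * c2 + 7/24 * c1^3)\<close>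
  at the origin (\<open>schippers_of_bean_subordinate\<close>).  The monomials \<open>\<omega> z = z\<^sup>2\<close> and \<open>\<omega> z = z^3\<close>
  therefore give the values \<open>1\<close> and \<open>3\<close>, and the theorem says that no Schwarz function does better.

  The coefficients of a Schwarz function are controlled by the Schur algorithm
  (\<open>schwarz_schur_step\<close>): \<open>c2 = q * d\<close> and \<open>c3 = q * (e - cnj c1 * d\<^sup>2)\<close>, where
  \<open>q = 1 - (cmod c1)\<^sup>2\<close> and \<open>cmod e \<le> 1 - (cmod d)\<^sup>2\<close>.  The bound for \<open>\<sigma>3\<close> then follows from the
  triangle inequality.  For \<open>\<sigma>4\<close> the triangle inequality may be spent only on \<open>e\<close>: bounding all
  terms separately gives more than \<open>3\<close>, for example at \<open>cmod c1 = 3/5\<close> and \<open>cmod d = 1\<close>.  What remains is a real polynomial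
  inequality, proved by completing a square (\<open>bean_cubic_real_inequality\<close>).
\<close>

(* Coefficients of power series and components of vectors compete for the symbol $. *)
unbundle no vec_syntax

section \<open>The bean function on the unit disc\<close>

lemma exp_not_nonpos_Real:
  fixes w :: complex
  assumes "\<bar>Im w\<bar> < pi"
  shows "exp w \<notin> \<real>\<^sub>\<le>\<^sub>0"
proof
  assume "exp w \<in> \<real>\<^sub>\<le>\<^sub>0"
  then have re: "Re (exp w) \<le> 0" and im: "Im (exp w) = 0"
    by (auto simp: complex_nonpos_Reals_iff)
  from im have "sin (Im w) = 0"
    by (simp add: Im_exp)
  with assms have "Im w = 0"
    using sin_eq_0_pi by (metis abs_less_iff minus_less_iff)
  with re show False
    by (simp add: Re_exp not_le [symmetric])
qed

lemma disc_exp_not_nonpos_Real: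
  assumes "z \<in> unit_disc"
  shows "exp (- 2 * z) \<notin> \<real>\<^sub>\<le>\<^sub>0"
proof (rule exp_not_nonpos_Real)
  have "\<bar>Im z\<bar> < 1"
    using assms abs_Im_le_cmod [of z] by simp
  then show "\<bar>Im (- 2 * z)\<bar> < pi"
    using pi_gt3 by simp
qed

text \<open>
  At a zero of \<open>cosh\<close> the value \<open>exp (- 2 * z)\<close> is \<open>- 1\<close>, which lies on the omitted ray.
\<close>

lemma disc_cosh_nonzero:
  fixes z :: complex
  assumes "z \<in> unit_disc"
  shows "cosh z \<noteq> 0"
proof
  have sq: "exp (- 2 * z) = exp (- z) * exp (- z)"
    by (simp flip: exp_add)
  assume "cosh z = 0"
  then have "exp z = - exp (- z)"
    by (simp add: cosh_def scaleR_conv_of_real add_eq_0_iff2)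
  then have "exp (- 2 * z) = - (exp z * exp (- z))"
    unfolding sq by simp
  also have "\<dots> = - 1"
    by (simp flip: exp_add)
  finally show False
    using disc_exp_not_nonpos_Real [OF assms] by simp
qed

lemma one_plus_tanh_eq:
  fixes z :: complex
  assumes "cosh z \<noteq> 0"
  shows "1 + tanh z = inverse ((1 + exp (- 2 * z)) / 2)"
proof -
  have sq: "exp (- 2 * z) = exp (- z) * exp (- z)"
    by (simp flip: exp_add)
  have inv: "exp z * exp (- z) = 1"
    by (simp flip: exp_add)
  have c: "2 * cosh z = exp z + exp (- z)"
    by (simp add: cosh_def scaleR_conv_of_real)
  have s: "2 * sinh z = exp z - exp (- z)"
    by (simp add: sinh_def scaleR_conv_of_real)
  have "1 + tanh z = (2 * cosh z + 2 * sinh z) / (2 * cosh z)"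
    using assms by (simp add: tanh_def field_simps)
  also have "\<dots> = 2 * exp z / (exp z * (1 + exp (- 2 * z)))"
    unfolding c s sq using inv by (simp add: algebra_simps)
  also have "\<dots> = inverse ((1 + exp (- 2 * z)) / 2)"
    by (simp add: divide_simps)
  finally show ?thesis .
qed

text \<open>
  The reciprocal of \<open>1 + tanh z\<close> is \<open>(1 + exp (- 2 * z)) / 2\<close>, which could only be a
  nonpositive real if \<open>exp (- 2 * z)\<close> were; that requires \<open>\<bar>Im z\<bar>\<close> to reach \<open>pi / 2 > 1\<close>.
\<close>

lemma disc_one_plus_tanh_slit:
  fixes z :: complex
  assumes "z \<in> unit_disc"
  shows "1 + tanh z \<notin> \<real>\<^sub>\<le>\<^sub>0"
proof
  assume "1 + tanh z \<in> \<real>\<^sub>\<le>\<^sub>0"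
  then have "(1 + exp (- 2 * z)) / 2 \<in> \<real>\<^sub>\<le>\<^sub>0"
    unfolding one_plus_tanh_eq [OF disc_cosh_nonzero [OF assms]]
    by (simp only: nonpos_Reals_inverse_iff)
  then have "exp (- 2 * z) \<in> \<real>\<^sub>\<le>\<^sub>0"
    by (auto simp: complex_nonpos_Reals_iff)
  with disc_exp_not_nonpos_Real [OF assms] show False ..
qed

lemma disc_bean_nonzero:
  assumes "z \<in> unit_disc"
  shows "bean z \<noteq> 0"
  using disc_one_plus_tanh_slit [OF assms] by (auto simp: bean_def)

text \<open>
  The logarithmic derivative of the bean function is elementary because
  \<open>1 - tanh\<^sup>2 = (1 - tanh) (1 + tanh)\<close> cancels against \<open>bean\<^sup>2 = 1 + tanh\<close>.
\<close>

lemma bean_has_field_derivative: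
  assumes "z \<in> unit_disc"
  shows "(bean has_field_derivative bean z * (1 - tanh z) / 2) (at z)"
proof -
  have sq: "csqrt (1 + tanh z) * csqrt (1 + tanh z) = 1 + tanh z"
    by (metis power2_csqrt power2_eq_square)
  have nz: "csqrt (1 + tanh z) \<noteq> 0"
    using disc_bean_nonzero [OF assms] by (simp add: bean_def)
  have "((\<lambda>z. csqrt (1 + tanh z)) has_field_derivative
          (1 - (tanh z)\<^sup>2) / (2 * csqrt (1 + tanh z))) (at z)"
    using disc_one_plus_tanh_slit [OF assms] disc_cosh_nonzero [OF assms]
    by (auto intro!: derivative_eq_intros)
  also have "(1 - (tanh z)\<^sup>2) / (2 * csqrt (1 + tanh z)) = bean z * (1 - tanh z) / 2"
  proof -
    have "1 - (tanh z)\<^sup>2 = (csqrt (1 + tanh z) * csqrt (1 + tanh z)) * (1 - tanh z)"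
      unfolding sq by (simp add: power2_eq_square algebra_simps)
    then have "(1 - (tanh z)\<^sup>2) / (2 * csqrt (1 + tanh z))
        = csqrt (1 + tanh z) * (csqrt (1 + tanh z) * (1 - tanh z)) / (csqrt (1 + tanh z) * 2)"
      by (simp only: mult_ac)
    also have "\<dots> = csqrt (1 + tanh z) * (1 - tanh z) / 2"
      using nz by (subst mult_divide_mult_cancel_left) simp_all
    finally show ?thesis
      by (simp add: bean_def)
  qed
  finally show ?thesis
    unfolding bean_def [abs_def] .
qed

lemma bean_holomorphic: "bean holomorphic_on unit_disc"
  using bean_has_field_derivative
  by (meson field_differentiable_at_within field_differentiable_def holomorphic_on_def)

section \<open>Coefficients of Schwarz functions\<close>

lemma schwarz_has_fps_expansion:
  assumes "schwarz_function \<omega>"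
  shows "\<omega> has_fps_expansion fps_expansion \<omega> 0"
  using assms unfolding schwarz_function_def
  by (intro has_fps_expansion_fps_expansion [of unit_disc]) auto

lemma schwarz_coeff0:
  fixes W :: "complex fps"
  assumes "schwarz_function \<omega>" "\<omega> has_fps_expansion W"
  shows "W $ 0 = 0"
  using assms has_fps_expansion_imp_0_eq_fps_nth_0 unfolding schwarz_function_def by metis

lemma has_fps_expansion_disc_cong:
  fixes f g :: "complex \<Rightarrow> complex"
  assumes "f has_fps_expansion F" "\<And>z. z \<in> unit_disc \<Longrightarrow> f z = g z"
  shows "g has_fps_expansion F"
proof -
  have "eventually (\<lambda>z. z \<in> unit_disc) (nhds (0::complex))"
    by (intro eventually_nhds_in_open) auto
  then have "eventually (\<lambda>z. f z = g z) (nhds 0)"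
    by eventually_elim (rule assms(2))
  with assms(1) show ?thesis
    using has_fps_expansion_cong [OF _ refl] by metis
qed

lemma deriv_disc_cong:
  fixes f g :: "complex \<Rightarrow> complex"
  assumes "\<And>w. w \<in> unit_disc \<Longrightarrow> f w = g w" "z \<in> unit_disc"
  shows "deriv f z = deriv g z"
proof (rule deriv_cong_ev)
  have "eventually (\<lambda>w. w \<in> unit_disc) (nhds z)"
    using assms(2) by (intro eventually_nhds_in_open) auto
  then show "eventually (\<lambda>w. f w = g w) (nhds z)"
    by eventually_elim (rule assms(1))
qed simp

lemma deriv_0_eq_coeff1:
  assumes "f has_fps_expansion F"
  shows "deriv f (0::complex) = F $ 1"
  using has_fps_expansion_imp_0_eq_fps_nth_0 [OF has_fps_expansion_deriv [OF assms]] by simp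

lemma schwarz_coeff1:
  fixes W :: "complex fps"
  assumes "schwarz_function \<omega>" "\<omega> has_fps_expansion W"
  shows "cmod (W $ 1) \<le> 1"
  using Schwarz_Lemma(2) [of \<omega> 0] assms(1) deriv_0_eq_coeff1 [OF assms(2)]
  by (auto simp: schwarz_function_def)

lemma schwarz_extremal_fps:
  fixes W :: "complex fps"
  assumes "schwarz_function \<omega>" "\<omega> has_fps_expansion W" "cmod (W $ 1) = 1"
  shows "W = fps_const (W $ 1) * fps_X"
proof -
  obtain \<alpha> where \<alpha>: "\<And>z. cmod z < 1 \<Longrightarrow> \<omega> z = \<alpha> * z"
    using Schwarz_Lemma(3) [of \<omega> 0] assms(1,3) deriv_0_eq_coeff1 [OF assms(2)]
    by (auto simp: schwarz_function_def)
  have "(\<lambda>z. \<alpha> * z) has_fps_expansion fps_const \<alpha> * fps_X"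
    by (intro fps_expansion_intros)
  then have "\<omega> has_fps_expansion fps_const \<alpha> * fps_X"
    by (rule has_fps_expansion_disc_cong) (simp add: \<alpha>)
  then have "W = fps_const \<alpha> * fps_X"
    using fps_expansion_unique_complex assms(2) by blast
  then show ?thesis
    by simp
qed

text \<open>
  One step of the Schur algorithm: divide by \<open>z\<close>, then move the value at the origin to \<open>0\<close> by
  a Moebius transformation.  The result is again a Schwarz function, and the division-free identity
  between the power series turns bounds on its coefficients into bounds one order higher.
\<close>

lemma schwarz_schur_step:
  fixes W :: "complex fps"
  assumes \<omega>: "schwarz_function \<omega>" and W: "\<omega> has_fps_expansion W" and lt: "cmod (W $ 1) < 1"
  obtains \<psi> and P :: "complex fps" where "schwarz_function \<psi>" "\<psi> has_fps_expansion P"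
    "P * (1 - fps_const (cnj (W $ 1)) * fps_shift 1 W) = fps_shift 1 W - fps_const (W $ 1)"
proof -
  define a where "a = W $ 1"
  have hol: "\<omega> holomorphic_on ball 0 1" and \<omega>0: "\<omega> 0 = 0"
    and \<omega>1: "\<And>z. cmod z < 1 \<Longrightarrow> cmod (\<omega> z) < 1"
    using \<omega> by (auto simp: schwarz_function_def)
  have d: "deriv \<omega> 0 = a"
    using deriv_0_eq_coeff1 [OF W] by (simp add: a_def)
  obtain \<phi> where \<phi>: "\<phi> holomorphic_on ball 0 1" "\<And>z. cmod z < 1 \<Longrightarrow> \<omega> z = z * \<phi> z" "\<phi> 0 = a"
    using Schwarz3 [OF hol \<omega>0] d by metis
  have \<phi>1: "cmod (\<phi> z) < 1" if z: "cmod z < 1" for z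
  proof (cases "z = 0")
    case True
    then show ?thesis
      using lt \<phi>(3) by (simp add: a_def)
  next
    case False
    \<comment> \<open>Equality in Schwarz's lemma would force the excluded case of a rotation.\<close>
    have "cmod (\<omega> z) \<noteq> cmod z"
    proof
      assume "cmod (\<omega> z) = cmod z"
      then obtain \<alpha> where \<alpha>: "\<And>z. cmod z < 1 \<Longrightarrow> \<omega> z = \<alpha> * z" "cmod \<alpha> = 1"
        using Schwarz_Lemma(3) [OF hol \<omega>0 \<omega>1 z] False z by blast
      have "deriv \<omega> 0 = deriv (\<lambda>z. \<alpha> * z) 0"
        by (rule deriv_disc_cong) (simp_all add: \<alpha>)
      then have "a = \<alpha>"
        using d by simp
      with \<alpha>(2) lt show False
        by (simp add: a_def)
    qed
    then have "cmod z * cmod (\<phi> z) < cmod z * 1"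
      using Schwarz_Lemma(1) [OF hol \<omega>0 \<omega>1 z] \<phi>(2) [OF z] by (simp add: norm_mult)
    then show ?thesis
      using False by simp
  qed
  define \<psi> where "\<psi> z = Moebius_function 0 a (\<phi> z)" for z
  have a1: "cmod a < 1"
    using lt by (simp add: a_def)
  have \<psi>: "schwarz_function \<psi>"
    unfolding schwarz_function_def
  proof (intro conjI ballI)
    show "\<psi> holomorphic_on unit_disc"
      using holomorphic_on_compose_gen [OF \<phi>(1) Moebius_function_holomorphic [OF a1], of 0] \<phi>1
      by (simp add: \<psi>_def [abs_def] o_def image_subset_iff)
    show "\<psi> 0 = 0"
      by (simp add: \<psi>_def \<phi>(3) Moebius_function_eq_zero)
    show "cmod (\<psi> z) < 1" if "z \<in> unit_disc" for z
      using that a1 \<phi>1 by (simp add: \<psi>_def Moebius_function_norm_lt_1)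
  qed
  define P where "P = fps_expansion \<psi> 0"
  define G where "G = fps_expansion \<phi> 0"
  have P: "\<psi> has_fps_expansion P"
    unfolding P_def by (rule schwarz_has_fps_expansion [OF \<psi>])
  have G: "\<phi> has_fps_expansion G"
    unfolding G_def by (rule has_fps_expansion_fps_expansion [OF _ _ \<phi>(1)]) auto
  have "(\<lambda>z. z * \<phi> z) has_fps_expansion fps_X * G"
    by (intro fps_expansion_intros G)
  then have "\<omega> has_fps_expansion fps_X * G"
    by (rule has_fps_expansion_disc_cong) (simp add: \<phi>(2))
  then have "W = fps_X * G"
    using fps_expansion_unique_complex W by blast
  then have GW: "G = fps_shift 1 W"
    by (simp add: fps_eq_iff)
  have eq: "\<psi> z * (1 - cnj a * \<phi> z) = \<phi> z - a" if z: "z \<in> unit_disc" for z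
  proof -
    have "cmod (cnj a * \<phi> z) < 1"
      using norm_mult_less [of "cnj a" 1 "\<phi> z" 1] a1 \<phi>1 z by simp
    then have "1 - cnj a * \<phi> z \<noteq> 0"
      by auto
    then show ?thesis
      by (simp add: \<psi>_def Moebius_function_simple)
  qed
  have "(\<lambda>z. \<psi> z * (1 - cnj a * \<phi> z)) has_fps_expansion P * (1 - fps_const (cnj a) * G)"
    by (intro fps_expansion_intros P G)
  then have "(\<lambda>z. \<phi> z - a) has_fps_expansion P * (1 - fps_const (cnj a) * G)"
    by (rule has_fps_expansion_disc_cong) (rule eq)
  moreover have "(\<lambda>z. \<phi> z - a) has_fps_expansion G - fps_const a"
    by (intro fps_expansion_intros G)
  ultimately have "P * (1 - fps_const (cnj a) * G) = G - fps_const a"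
    using fps_expansion_unique_complex by blast
  with \<psi> P show ?thesis
    using that unfolding GW a_def by blast
qed

lemma schwarz_schur_step_coeffs:
  fixes W :: "complex fps"
  assumes \<omega>: "schwarz_function \<omega>" and W: "\<omega> has_fps_expansion W" and lt: "cmod (W $ 1) < 1"
  obtains \<psi> and P :: "complex fps" where "schwarz_function \<psi>" "\<psi> has_fps_expansion P"
    "W $ 2 = (1 - (cmod (W $ 1))\<^sup>2) * P $ 1"
    "W $ 3 = (1 - (cmod (W $ 1))\<^sup>2) * (P $ 2 - cnj (W $ 1) * (P $ 1)\<^sup>2)"
proof -
  obtain \<psi> and P :: "complex fps" where \<psi>: "schwarz_function \<psi>" and P: "\<psi> has_fps_expansion P"
    and eq: "P * (1 - fps_const (cnj (W $ 1)) * fps_shift 1 W) = fps_shift 1 W - fps_const (W $ 1)"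
    using schwarz_schur_step [OF assms] by blast
  have P0: "P $ 0 = 0"
    by (rule schwarz_coeff0 [OF \<psi> P])
  have n: "complex_of_real ((cmod (W $ 1))\<^sup>2) = W $ 1 * cnj (W $ 1)"
    by (rule complex_norm_square)
  have 1: "W $ 2 = (1 - (cmod (W $ 1))\<^sup>2) * P $ 1"
    using arg_cong [OF eq, of "\<lambda>F. F $ 1"] P0 n
    by (simp add: fps_mult_nth numeral_2_eq_2 algebra_simps)
  have "W $ 3 = (1 - (cmod (W $ 1))\<^sup>2) * P $ 2 - P $ 1 * cnj (W $ 1) * W $ 2"
    using arg_cong [OF eq, of "\<lambda>F. F $ 2"] P0 n
    by (simp add: fps_mult_nth numeral_2_eq_2 numeral_3_eq_3 algebra_simps)
  then have "W $ 3 = (1 - (cmod (W $ 1))\<^sup>2) * (P $ 2 - cnj (W $ 1) * (P $ 1)\<^sup>2)"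
    unfolding 1 by (simp add: algebra_simps power2_eq_square)
  with \<psi> P 1 show ?thesis
    using that by blast
qed

lemma schwarz_coeff2:
  fixes W :: "complex fps"
  assumes \<omega>: "schwarz_function \<omega>" and W: "\<omega> has_fps_expansion W"
  shows "cmod (W $ 2) \<le> 1 - (cmod (W $ 1))\<^sup>2"
proof (cases "cmod (W $ 1) = 1")
  case True
  then show ?thesis
    by (subst schwarz_extremal_fps [OF \<omega> W]) simp_all
next
  case False
  then have lt: "cmod (W $ 1) < 1"
    using schwarz_coeff1 [OF \<omega> W] by simp
  obtain \<psi> and P :: "complex fps" where \<psi>: "schwarz_function \<psi>" "\<psi> has_fps_expansion P"
    and eq: "W $ 2 = (1 - (cmod (W $ 1))\<^sup>2) * P $ 1"
    using schwarz_schur_step_coeffs [OF \<omega> W lt] by blast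
  have q: "0 \<le> 1 - (cmod (W $ 1))\<^sup>2"
    using lt by (simp add: power_le_one)
  have "cmod (W $ 2) = (1 - (cmod (W $ 1))\<^sup>2) * cmod (P $ 1)"
    unfolding eq norm_mult using q by (metis norm_of_real abs_of_nonneg of_real_1 of_real_diff)
  also have "\<dots> \<le> (1 - (cmod (W $ 1))\<^sup>2) * 1"
    using schwarz_coeff1 [OF \<psi>] q by (rule mult_left_mono)
  finally show ?thesis
    by simp
qed

text \<open>
  The parameters \<open>d\<close> and \<open>e\<close> are the first two coefficients of the next Schur iterate, to which the
  second-order bound applies; for a rotation, where there is no next iterate, both may be \<open>0\<close>.
\<close>

lemma schwarz_coeffs_parametrization:
  fixes W :: "complex fps"
  assumes \<omega>: "schwarz_function \<omega>" and W: "\<omega> has_fps_expansion W"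
  obtains d e :: complex where "cmod e \<le> 1 - (cmod d)\<^sup>2"
    "W $ 2 = (1 - (cmod (W $ 1))\<^sup>2) * d"
    "W $ 3 = (1 - (cmod (W $ 1))\<^sup>2) * (e - cnj (W $ 1) * d\<^sup>2)"
proof (cases "cmod (W $ 1) = 1")
  case True
  have "W $ 2 = 0" "W $ 3 = 0"
    by (subst schwarz_extremal_fps [OF \<omega> W True], simp)+
  with True show ?thesis
    using that [of 0 0] by simp
next
  case False
  then have lt: "cmod (W $ 1) < 1"
    using schwarz_coeff1 [OF \<omega> W] by simp
  obtain \<psi> and P :: "complex fps" where "schwarz_function \<psi>" "\<psi> has_fps_expansion P"
    and c: "W $ 2 = (1 - (cmod (W $ 1))\<^sup>2) * P $ 1"
      "W $ 3 = (1 - (cmod (W $ 1))\<^sup>2) * (P $ 2 - cnj (W $ 1) * (P $ 1)\<^sup>2)"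
    by (rule schwarz_schur_step_coeffs [OF \<omega> W lt])
  then have "cmod (P $ 2) \<le> 1 - (cmod (P $ 1))\<^sup>2"
    by (intro schwarz_coeff2)
  then show ?thesis
    using c by (rule that)
qed

section \<open>The cubic coefficient inequality\<close>

text \<open>
  The difference of the two sides, made homogeneous by \<open>p + q = 1\<close> and with \<open>s = Re x\<close> and
  \<open>R = (cmod x)\<^sup>2\<close>, is \<open>q\<close> times a quadratic in \<open>q * R\<close> and \<open>p\<close>, plus a positive multiple of \<open>p ^ 3\<close>.
  Completing the square in \<open>q * R\<close> leaves \<open>p\<^sup>2\<close> times a polynomial that is at least
  \<open>63/64 + s/2 + s\<^sup>2/3 > 0\<close> because \<open>s\<^sup>2 \<le> R\<close>.
\<close>

lemma bean_cubic_real_inequality: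
  fixes p q :: real and x :: complex
  assumes p: "0 \<le> p" and q: "0 \<le> q" and pq: "p + q = 1"
  shows "p * (cmod (q * x\<^sup>2 + 3/2 * q * x - 7/24 * p))\<^sup>2 \<le> (p + q * (cmod x)\<^sup>2)\<^sup>2"
proof -
  define s t R where "s = Re x" and "t = Im x" and "R = s\<^sup>2 + t\<^sup>2"
  have R: "(cmod x)\<^sup>2 = R"
    by (simp add: R_def s_def t_def cmod_power2)
  have N: "(cmod (q * x\<^sup>2 + 3/2 * q * x - 7/24 * p))\<^sup>2
      = (q * (s\<^sup>2 - t\<^sup>2) + 3/2 * q * s - 7/24 * p)\<^sup>2 + (q * (2 * s * t) + 3/2 * q * t)\<^sup>2"
    unfolding cmod_power2 by (simp add: s_def t_def power2_eq_square algebra_simps)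
  also have "\<dots> = q\<^sup>2 * (9/4 * R + R\<^sup>2 + 3 * s * R) + 49/576 * p\<^sup>2
      - 7/12 * p * q * (2 * s\<^sup>2 - R + 3/2 * s)"
    unfolding R_def by (simp add: power2_eq_square field_simps) 
  finally have N': "(cmod (q * x\<^sup>2 + 3/2 * q * x - 7/24 * p))\<^sup>2 = q\<^sup>2 * (9/4 * R + R\<^sup>2 + 3 * s * R)
      + 49/576 * p\<^sup>2 - 7/12 * p * q * (2 * s\<^sup>2 - R + 3/2 * s)" .
  have pos: "0 \<le> 63/64 + s/2 + s\<^sup>2/3"
  proof -
    have "63/64 + s/2 + s\<^sup>2/3 = (s + 3/4)\<^sup>2/3 + 51/64"
      by (simp add: power2_eq_square field_simps)
    then show ?thesis
      by simp
  qed
  have "0 \<le> R - s\<^sup>2"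
    by (simp add: R_def)
  then have "0 \<le> 17/12 * (R - s\<^sup>2)"
    by simp
  with pos have m: "0 \<le> (63/64 + s/2 + s\<^sup>2/3) + 17/12 * (R - s\<^sup>2)"
    by (rule add_nonneg_nonneg)
  have "0 \<le> q * ((q * R - p * (1/4 + 3 * s) / 2)\<^sup>2
      + p\<^sup>2 * ((63/64 + s/2 + s\<^sup>2/3) + 17/12 * (R - s\<^sup>2))) + 527/576 * p^3"
    using add_nonneg_nonneg [OF mult_nonneg_nonneg [OF q
        add_nonneg_nonneg [OF zero_le_power2 mult_nonneg_nonneg [OF zero_le_power2 m]]]] p
    by simp
  also have "\<dots> = (p + q) * (p + q * R)\<^sup>2 - p * (q\<^sup>2 * (9/4 * R + R\<^sup>2 + 3 * s * R)
      + 49/576 * p\<^sup>2 - 7/12 * p * q * (2 * s\<^sup>2 - R + 3/2 * s))"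
    by (simp add: power2_eq_square power3_eq_cube algebra_simps
        add_divide_distrib diff_divide_distrib)
  finally show ?thesis
    unfolding N' R pq by simp
qed

text \<open>
  A rotation makes \<open>a\<close> real and turns the left-hand side into the modulus estimated above.
\<close>

lemma bean_cubic_complex_inequality:
  fixes a d :: complex and q :: real
  assumes a1: "cmod a \<le> 1" and q_def: "q = 1 - (cmod a)\<^sup>2"
  shows "cmod (q * (cnj a * d\<^sup>2) + 3/2 * q * (a * d) - 7/24 * a^3) \<le> (cmod a)\<^sup>2 + q * (cmod d)\<^sup>2"
proof -
  define \<rho> p where "\<rho> = cmod a" and "p = \<rho>\<^sup>2"
  have \<rho>: "0 \<le> \<rho>"
    by (simp add: \<rho>_def)
  have p: "0 \<le> p" and q: "0 \<le> q" and pq: "p + q = 1"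
    using a1 by (simp_all add: p_def q_def \<rho>_def power_le_one)
  define u where "u = cis (Arg a)"
  have a: "a = \<rho> * u"
    using rcis_cmod_Arg [of a] by (simp add: u_def \<rho>_def rcis_def)
  have u: "cmod u = 1" and ucu: "u * cnj u = 1"
    by (simp_all add: u_def cis_cnj cis_mult)
  define x where "x = d * (cnj u)\<^sup>2"
  have d: "d = u\<^sup>2 * x"
  proof -
    have "u\<^sup>2 * x = (u * cnj u)\<^sup>2 * d"
      by (simp add: x_def power_mult_distrib mult_ac)
    then show ?thesis
      by (simp add: ucu)
  qed
  have cx: "cmod x = cmod d"
    by (simp add: d norm_mult norm_power u)
  have 1: "cnj a * d\<^sup>2 = \<rho> * (u^3 * x\<^sup>2)"
  proof -
    have "cnj a * d\<^sup>2 = \<rho> * ((u * cnj u) * (u^3 * x\<^sup>2))"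
      by (simp only: a d complex_cnj_mult complex_cnj_complex_of_real power2_eq_square
          power3_eq_cube mult_ac)
    then show ?thesis
      by (simp add: ucu)
  qed
  have 2: "a * d = \<rho> * (u^3 * x)"
    by (simp only: a d power2_eq_square power3_eq_cube mult_ac)
  have 3: "a^3 = \<rho> * (u^3 * p)"
    by (simp only: a p_def power2_eq_square power3_eq_cube mult_ac of_real_mult)
  have "q * (cnj a * d\<^sup>2) + 3/2 * q * (a * d) - 7/24 * a^3
      = \<rho> * (u^3 * (q * x\<^sup>2 + 3/2 * q * x - 7/24 * p))"
    unfolding 1 2 3 by (simp add: algebra_simps)
  then have "cmod (q * (cnj a * d\<^sup>2) + 3/2 * q * (a * d) - 7/24 * a^3)
      = \<rho> * cmod (q * x\<^sup>2 + 3/2 * q * x - 7/24 * p)"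
    using \<rho> by (simp only: norm_mult norm_power u norm_of_real) simp
  also have "\<dots> \<le> p + q * (cmod x)\<^sup>2"
  proof (rule power2_le_imp_le)
    show "(\<rho> * cmod (q * x\<^sup>2 + 3/2 * q * x - 7/24 * p))\<^sup>2 \<le> (p + q * (cmod x)\<^sup>2)\<^sup>2"
      using bean_cubic_real_inequality [OF p q pq, of x]
      by (simp only: power_mult_distrib p_def)
    show "0 \<le> p + q * (cmod x)\<^sup>2"
      using p q by simp
  qed
  finally show ?thesis
    by (simp only: cx p_def \<rho>_def)
qed

lemma schwarz_cubic_functional_bound:
  fixes W :: "complex fps"
  assumes \<omega>: "schwarz_function \<omega>" and W: "\<omega> has_fps_expansion W"
  shows "cmod (W $ 3 - 3/2 * W $ 1 * W $ 2 + 7/24 * (W $ 1)^3) \<le> 1"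
proof -
  define q where "q = 1 - (cmod (W $ 1))\<^sup>2"
  obtain d e :: complex where de: "cmod e \<le> 1 - (cmod d)\<^sup>2" and c2: "W $ 2 = q * d"
    and c3: "W $ 3 = q * (e - cnj (W $ 1) * d\<^sup>2)"
    unfolding q_def by (rule schwarz_coeffs_parametrization [OF \<omega> W])
  have a1: "cmod (W $ 1) \<le> 1"
    by (rule schwarz_coeff1 [OF \<omega> W])
  then have q: "0 \<le> q"
    by (simp add: q_def power_le_one)
  have "W $ 3 - 3/2 * W $ 1 * W $ 2 + 7/24 * (W $ 1)^3
      = q * e - (q * (cnj (W $ 1) * d\<^sup>2) + 3/2 * q * (W $ 1 * d) - 7/24 * (W $ 1)^3)"
    unfolding c2 c3 by (simp add: algebra_simps)
  also have "cmod \<dots> \<le> cmod (q * e)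
      + cmod (q * (cnj (W $ 1) * d\<^sup>2) + 3/2 * q * (W $ 1 * d) - 7/24 * (W $ 1)^3)"
    by (rule norm_triangle_ineq4)
  also have "\<dots> \<le> q * (1 - (cmod d)\<^sup>2) + ((cmod (W $ 1))\<^sup>2 + q * (cmod d)\<^sup>2)"
  proof (rule add_mono)
    show "cmod (q * e) \<le> q * (1 - (cmod d)\<^sup>2)"
      using mult_left_mono [OF de q] q by (simp add: norm_mult)
  qed (rule bean_cubic_complex_inequality [OF a1 q_def])
  also have "\<dots> = 1"
    by (simp add: q_def algebra_simps)
  finally show ?thesis .
qed

lemma schwarz_quadratic_functional_bound:
  fixes W :: "complex fps"
  assumes \<omega>: "schwarz_function \<omega>" and W: "\<omega> has_fps_expansion W"
  shows "cmod (W $ 2 - 5/8 * (W $ 1)\<^sup>2) \<le> 1"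
proof -
  have "cmod (W $ 2 - 5/8 * (W $ 1)\<^sup>2) \<le> cmod (W $ 2) + cmod (5/8 * (W $ 1)\<^sup>2)"
    by (rule norm_triangle_ineq4)
  also have "\<dots> = cmod (W $ 2) + 5/8 * (cmod (W $ 1))\<^sup>2"
    by (simp add: norm_mult norm_power norm_divide)
  also have "\<dots> \<le> 1"
    using schwarz_coeff2 [OF \<omega> W] zero_le_power2 [of "cmod (W $ 1)"] by linarith
  finally show ?thesis .
qed

section \<open>Schwarzian derivatives in terms of the Schwarz function\<close>

text \<open>
  Comparing coefficients in the differential equation \<open>h' = (1 - h\<^sup>2) * \<omega>'\<close> for \<open>h = tanh \<circ> \<omega>\<close>
  avoids composing power series.  Through order two \<open>h\<close> agrees with \<open>\<omega>\<close>, since \<open>tanh\<close> is odd.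
\<close>

lemma tanh_comp_schwarz_expansion:
  fixes W :: "complex fps"
  assumes \<omega>: "schwarz_function \<omega>" and W: "\<omega> has_fps_expansion W"
  obtains H where "(\<lambda>z. tanh (\<omega> z)) has_fps_expansion H"
    "H $ 0 = 0" "H $ 1 = W $ 1" "H $ 2 = W $ 2"
proof -
  have hol: "\<omega> holomorphic_on unit_disc" and \<omega>0: "\<omega> 0 = 0"
    and \<omega>1: "\<And>z. z \<in> unit_disc \<Longrightarrow> \<omega> z \<in> unit_disc"
    using \<omega> by (auto simp: schwarz_function_def)
  have der: "((\<lambda>z. tanh (\<omega> z)) has_field_derivative (1 - (tanh (\<omega> z))\<^sup>2) * deriv \<omega> z) (at z)"
    if "z \<in> unit_disc" for z
    using disc_cosh_nonzero [OF \<omega>1 [OF that]] holomorphic_derivI [OF hol open_ball that]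
    by (auto intro!: derivative_eq_intros)
  define H where "H = fps_expansion (\<lambda>z. tanh (\<omega> z)) 0"
  have "(\<lambda>z. tanh (\<omega> z)) holomorphic_on unit_disc"
    using der by (meson field_differentiable_at_within field_differentiable_def holomorphic_on_def)
  then have H: "(\<lambda>z. tanh (\<omega> z)) has_fps_expansion H"
    unfolding H_def by (intro has_fps_expansion_fps_expansion [of unit_disc]) auto
  have H0: "H $ 0 = 0"
    using has_fps_expansion_imp_0_eq_fps_nth_0 [OF H] \<omega>0 by simp
  have "(\<lambda>z. (1 - (tanh (\<omega> z))\<^sup>2) * deriv \<omega> z) has_fps_expansion (1 - H\<^sup>2) * fps_deriv W"
    by (intro fps_expansion_intros H W)
  then have "deriv (\<lambda>z. tanh (\<omega> z)) has_fps_expansion (1 - H\<^sup>2) * fps_deriv W"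
    by (rule has_fps_expansion_disc_cong) (metis der DERIV_imp_deriv)
  then have ode: "fps_deriv H = (1 - H\<^sup>2) * fps_deriv W"
    using fps_expansion_unique_complex has_fps_expansion_deriv [OF H] by blast
  have H1: "H $ 1 = W $ 1"
    using arg_cong [OF ode, of "\<lambda>F. F $ 0"] H0 by (simp add: power2_eq_square)
  have "H $ 2 = W $ 2"
    using arg_cong [OF ode, of "\<lambda>F. F $ 1"] H0
    by (simp add: power2_eq_square fps_mult_nth numeral_2_eq_2)
  with H H0 H1 show ?thesis
    using that by blast
qed

text \<open>
  With \<open>T = f''/f'\<close> the Schwarzian is \<open>T' - T\<^sup>2/2\<close>, and \<open>T\<close> is the logarithmic derivative of
  \<open>bean \<circ> \<omega>\<close>, hence \<open>(1 - tanh \<omega>) \<omega>'/2\<close>.  So the square root never has to be expanded: the first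
  three Taylor coefficients of \<open>T\<close> determine both functionals.
\<close>

lemma schippers_of_bean_subordinate:
  fixes W :: "complex fps"
  assumes \<omega>: "schwarz_function \<omega>" and W: "\<omega> has_fps_expansion W"
    and f: "\<And>z. z \<in> unit_disc \<Longrightarrow> deriv f z = bean (\<omega> z)"
  shows "schippers 3 f 0 = W $ 2 - 5/8 * (W $ 1)\<^sup>2"
    and "schippers 4 f 0 = 3 * (W $ 3 - 3/2 * W $ 1 * W $ 2 + 7/24 * (W $ 1)^3)"
proof -
  have hol: "\<omega> holomorphic_on unit_disc" and \<omega>1: "\<And>z. z \<in> unit_disc \<Longrightarrow> \<omega> z \<in> unit_disc"
    using \<omega> by (auto simp: schwarz_function_def)
  define T where "T z = 1/2 * ((1 - tanh (\<omega> z)) * deriv \<omega> z)" for z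
  have T: "deriv (deriv f) z / deriv f z = T z" if z: "z \<in> unit_disc" for z
  proof -
    have "deriv (deriv f) z = deriv (\<lambda>z. bean (\<omega> z)) z"
      using f z by (rule deriv_disc_cong)
    also have "\<dots> = bean (\<omega> z) * (1 - tanh (\<omega> z)) / 2 * deriv \<omega> z"
      by (intro DERIV_imp_deriv DERIV_chain2 [where f = bean] bean_has_field_derivative \<omega>1 z
            holomorphic_derivI [OF hol open_ball z])
    finally show ?thesis
      using disc_bean_nonzero [OF \<omega>1 [OF z]] by (simp add: T_def f [OF z])
  qed
  have S: "schippers 3 f z = deriv T z - 1/2 * (T z)\<^sup>2" if z: "z \<in> unit_disc" for z
  proof -
    have "deriv (\<lambda>w. deriv (deriv f) w / deriv f w) z = deriv T z"
      using T z by (rule deriv_disc_cong)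
    then show ?thesis
      by (simp add: numeral_3_eq_3 T [OF z])
  qed
  obtain H where H: "(\<lambda>z. tanh (\<omega> z)) has_fps_expansion H"
    and H012: "H $ 0 = 0" "H $ 1 = W $ 1" "H $ 2 = W $ 2"
    using tanh_comp_schwarz_expansion [OF \<omega> W] by blast
  define F where "F = fps_const (1/2) * ((1 - H) * fps_deriv W)"
  have TF: "T has_fps_expansion F"
    unfolding T_def [abs_def] F_def by (intro fps_expansion_intros H W)
  have F0: "F $ 0 = W $ 1 / 2"
    by (simp add: F_def H012)
  have F1: "F $ 1 = W $ 2 - (W $ 1)\<^sup>2 / 2"
    using H012 by (simp add: F_def fps_mult_nth numeral_2_eq_2 power2_eq_square field_simps)
  have F2: "F $ 2 = 3/2 * W $ 3 - 3/2 * W $ 1 * W $ 2"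
    using H012
    by (simp add: F_def fps_mult_nth numeral_2_eq_2 numeral_3_eq_3 power2_eq_square field_simps)
  have "(\<lambda>z. deriv T z - 1/2 * (T z)\<^sup>2) has_fps_expansion fps_deriv F - fps_const (1/2) * F\<^sup>2"
    by (intro fps_expansion_intros TF)
  then have SF: "schippers 3 f has_fps_expansion fps_deriv F - fps_const (1/2) * F\<^sup>2"
    by (rule has_fps_expansion_disc_cong) (simp only: S)
  show s3: "schippers 3 f 0 = W $ 2 - 5/8 * (W $ 1)\<^sup>2"
  proof -
    have "schippers 3 f 0 = F $ 1 - 1/2 * (F $ 0)\<^sup>2"
      using has_fps_expansion_imp_0_eq_fps_nth_0 [OF SF] by (simp add: power2_eq_square)
    also have "\<dots> = W $ 2 - 5/8 * (W $ 1)\<^sup>2"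
      unfolding F0 F1 by (simp add: power2_eq_square field_simps)
    finally show ?thesis .
  qed
  have d: "deriv (schippers 3 f) 0 = 2 * F $ 2 - F $ 0 * F $ 1"
    using deriv_0_eq_coeff1 [OF SF]
    by (simp add: fps_mult_nth power2_eq_square numeral_2_eq_2 field_simps)
  have T0: "deriv (deriv f) 0 / deriv f 0 = F $ 0"
    using has_fps_expansion_imp_0_eq_fps_nth_0 [OF TF] T [of 0] by simp
  have "schippers 4 f 0 = deriv (schippers 3 f) 0 - 2 * schippers 3 f 0 * F $ 0"
  proof -
    have "schippers (Suc 3) f 0 = deriv (schippers 3 f) 0
        - of_nat (3 - 1) * schippers 3 f 0 * (deriv (deriv f) 0 / deriv f 0)"
      by (subst schippers.simps(2)) simp
    then show ?thesis
      unfolding T0 by simp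
  qed
  also have "\<dots> = 3 * (W $ 3 - 3/2 * W $ 1 * W $ 2 + 7/24 * (W $ 1)^3)"
    unfolding d s3 F0 F1 F2
    by (simp add: power2_eq_square power3_eq_cube algebra_simps add_divide_distrib diff_divide_distrib)
  finally show "schippers 4 f 0 = 3 * (W $ 3 - 3/2 * W $ 1 * W $ 2 + 7/24 * (W $ 1)^3)" .
qed

section \<open>The extremal functions\<close>

lemma schwarz_power:
  assumes "0 < n"
  shows "schwarz_function (\<lambda>z. z ^ n)"
  using assms unfolding schwarz_function_def
  by (auto intro!: holomorphic_intros simp: norm_power power_less_one_iff)

text \<open>
  Every Schwarz function yields a member of the class: on the convex disc, integrating along
  segments from the origin produces a primitive, by Cauchy's theorem for triangles.
\<close>

lemma bean_primitive:
  assumes \<omega>: "schwarz_function \<omega>"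
    and F: "\<And>z. F z = contour_integral (linepath 0 z) (\<lambda>\<zeta>. bean (\<omega> \<zeta>))"
  shows "F \<in> BT_bean" and "\<And>z. z \<in> unit_disc \<Longrightarrow> deriv F z = bean (\<omega> z)"
proof -
  have hol: "\<omega> holomorphic_on unit_disc" and \<omega>0: "\<omega> 0 = 0"
    and \<omega>1: "\<And>z. z \<in> unit_disc \<Longrightarrow> \<omega> z \<in> unit_disc"
    using \<omega> by (auto simp: schwarz_function_def)
  have g: "(\<lambda>\<zeta>. bean (\<omega> \<zeta>)) holomorphic_on unit_disc"
    using holomorphic_on_compose_gen [OF hol bean_holomorphic] \<omega>1
    by (simp add: o_def image_subset_iff)
  have der: "(F has_field_derivative bean (\<omega> z)) (at z)" if z: "z \<in> unit_disc" for z
  proof -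
    have "((\<lambda>x. contour_integral (linepath 0 x) (\<lambda>\<zeta>. bean (\<omega> \<zeta>))) has_field_derivative bean (\<omega> z))
        (at z within unit_disc)"
    proof (rule triangle_contour_integrals_convex_primitive)
      show "continuous_on unit_disc (\<lambda>\<zeta>. bean (\<omega> \<zeta>))"
        by (rule holomorphic_on_imp_continuous_on [OF g])
      show "contour_integral (linepath 0 b) (\<lambda>\<zeta>. bean (\<omega> \<zeta>))
          + contour_integral (linepath b c) (\<lambda>\<zeta>. bean (\<omega> \<zeta>))
          + contour_integral (linepath c 0) (\<lambda>\<zeta>. bean (\<omega> \<zeta>)) = 0"
        if "b \<in> unit_disc" "c \<in> unit_disc" for b c
      proof -
        have "path_image (linepath 0 b +++ linepath b c +++ linepath c 0) \<subseteq> unit_disc"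
          using that by (simp add: path_image_join closed_segment_subset)
        then show ?thesis
          by (intro has_chain_integral_chain_integral3 Cauchy_theorem_convex_simple [OF g]) auto
      qed
    qed (use z in auto)
    then show ?thesis
      using z at_within_open [OF z open_ball] by (simp add: F [abs_def])
  qed
  show d: "deriv F z = bean (\<omega> z)" if "z \<in> unit_disc" for z
    using der [OF that] by (rule DERIV_imp_deriv)
  have "F holomorphic_on unit_disc"
    using der by (meson field_differentiable_at_within field_differentiable_def holomorphic_on_def)
  moreover have "F 0 = 0"
    by (simp add: F)
  moreover have "deriv F 0 = 1"
    using d [of 0] by (simp add: \<omega>0 bean_def)
  ultimately have "F \<in> class_A"
    by (simp add: class_A_def)
  moreover have "deriv F \<prec>\<^sub>s bean"
    unfolding subordinate_def
  proof (intro conjI exI [of _ \<omega>] ballI)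
    show "deriv F holomorphic_on unit_disc"
      using g by (rule holomorphic_transform) (simp add: d)
  qed (use \<omega> d bean_holomorphic in auto)
  ultimately show "F \<in> BT_bean"
    by (simp add: BT_bean_def)
qed

theorem theorem3p3:
  "(\<forall>f \<in> BT_bean. cmod (schippers 3 f 0) \<le> 1 \<and> cmod (schippers 4 f 0) \<le> 3) \<and>
   f5 \<in> BT_bean \<and> cmod (schippers 3 f5 0) = 1 \<and>
   f6 \<in> BT_bean \<and> cmod (schippers 4 f6 0) = 3"
proof (intro conjI ballI)
  fix f
  assume "f \<in> BT_bean"
  then obtain \<omega> where \<omega>: "schwarz_function \<omega>"
    and f: "\<And>z. z \<in> unit_disc \<Longrightarrow> deriv f z = bean (\<omega> z)"
    by (auto simp: BT_bean_def subordinate_def)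
  note W = schwarz_has_fps_expansion [OF \<omega>]
  show "cmod (schippers 3 f 0) \<le> 1"
    using schwarz_quadratic_functional_bound [OF \<omega> W]
    by (subst schippers_of_bean_subordinate(1) [OF \<omega> W f])
  show "cmod (schippers 4 f 0) \<le> 3"
  proof -
    have "schippers 4 f 0 = 3 * (fps_expansion \<omega> 0 $ 3
        - 3/2 * fps_expansion \<omega> 0 $ 1 * fps_expansion \<omega> 0 $ 2 + 7/24 * (fps_expansion \<omega> 0 $ 1)^3)"
      by (rule schippers_of_bean_subordinate(2) [OF \<omega> W f])
    then show ?thesis
      using mult_left_mono [OF schwarz_cubic_functional_bound [OF \<omega> W], of 3]
      by (simp only: norm_mult norm_numeral) simp
  qed
next
  have \<omega>: "schwarz_function (\<lambda>z. z ^ 2)"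
    by (rule schwarz_power) simp
  have W: "(\<lambda>z::complex. z ^ 2) has_fps_expansion fps_X ^ 2"
    by (intro fps_expansion_intros)
  have F: "f5 z = contour_integral (linepath 0 z) (\<lambda>\<zeta>. bean (\<zeta> ^ 2))" for z
    by (simp add: f5_def bean_def)
  show "f5 \<in> BT_bean"
    by (rule bean_primitive(1) [OF \<omega> F])
  show "cmod (schippers 3 f5 0) = 1"
    by (subst schippers_of_bean_subordinate(1) [OF \<omega> W bean_primitive(2) [OF \<omega> F]])
       (simp_all add: fps_X_power_nth)
next
  have \<omega>: "schwarz_function (\<lambda>z. z ^ 3)"
    by (rule schwarz_power) simp
  have W: "(\<lambda>z::complex. z ^ 3) has_fps_expansion fps_X ^ 3"
    by (intro fps_expansion_intros)
  have F: "f6 z = contour_integral (linepath 0 z) (\<lambda>\<zeta>. bean (\<zeta> ^ 3))" for z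
    by (simp add: f6_def bean_def)
  show "f6 \<in> BT_bean"
    by (rule bean_primitive(1) [OF \<omega> F])
  show "cmod (schippers 4 f6 0) = 3"
    by (subst schippers_of_bean_subordinate(2) [OF \<omega> W bean_primitive(2) [OF \<omega> F]])
       (simp_all add: fps_X_power_nth)
qed

end
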